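(* (i) For every integer $k\ge 0$ there exists a sequence of finite multisets $\xi$ of real numbers, of increasing size $|\xi|$, along which the transit time under the mean-median map satisfies $$\tau(\xi)\sim \sqrt{\frac{3k+5}{k+1}}\;|\xi|.$$ (ii) There exists a sequence of finite multisets $\xi$ of real numbers, of increasing size $|\xi|$, along which $$\tau(\xi)\sim \frac{|\xi|^2}{2}.$$
   Context: Finite multisets of real numbers are called sets; $|\xi|$ is the number of elements of $\xi$ counted with multiplicity. For a finite nonempty multiset $\xi$ of real numbers, $\mathcal{S}(\xi)$ is the sum of its elements (with multiplicity) and $\mathcal{M}(\xi)$ is its median: the central element of the ordered list of elements if $|\xi|$ is odd, and the mean of the two central elements if $|\xi|$ is even. Mean-median map: given an initial set $\xi=\xi_{n_0}=[x_1,\ldots,x_{n_0}]$ with $n_0=|\xi|\ge 1$, define recursively for every $n\ge n_0$ $$x_{n+1}=(n+1)\mathcal{M}(\xi_n)-\mathcal{S}(\xi_n),\qquad \xi_{n+1}=\xi_n\uplus[x_{n+1}],$$ where $\uplus[x_{n+1}]$ means adjoining $x_{n+1}$ (increasing its multiplicity by one). Thus the mean of $\xi_{n+1}$ equals the median of $\xi_n$. Transit time: $\tau(\xi)\in\{n_0+1,n_0+2,\ldots\}\cup\{\infty\}$ is the time step at which the sequence $(x_n)_{n>n_0}$ of new numbers becomes constant, i.e. the smallest $t>n_0$ such that $x_m=x_t$ for all $m\ge t$, and $\tau(\xi)=\infty$ if there is no such $t$. For a sequence of sets of increasing size, $\tau(\xi)\sim f(|\xi|)$ means that $\tau(\xi)/f(|\xi|)\to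 1$ along the sequence, as $|\xi|\to\infty$. *)

theory Defs
  imports Complex_Main "HOL-Library.Multiset" "HOL-Library.Extended_Real"
begin

definition median :: "real multiset \<Rightarrow> real" where
  "median \<xi> =
     (let xs = sorted_list_of_multiset \<xi>; n = size \<xi>
      in if odd n then xs ! (n div 2) else (xs ! (n div 2 - 1) + xs ! (n div 2)) / 2)"

definition mm_next :: "real multiset \<Rightarrow> real" where
  "mm_next \<xi> = real (size \<xi> + 1) * median \<xi> - sum_mset \<xi>"

definition mm_step :: "real multiset \<Rightarrow> real multiset" where
  "mm_step \<xi> = add_mset (mm_next \<xi>) \<xi>"

text \<open>The index \<open>n\<close> is absolute, i.e. it is the size of the set reached; the values of
  \<open>mm_set \<xi> n\<close> for \<open>n < size \<xi>\<close> and of \<open>mm_seq \<xi> n\<close> for \<open>n \<le> size \<xi>\<close> carry no meaning.\<close>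

definition mm_set :: "real multiset \<Rightarrow> nat \<Rightarrow> real multiset" where
  "mm_set \<xi> n = (mm_step ^^ (n - size \<xi>)) \<xi>"

definition mm_seq :: "real multiset \<Rightarrow> nat \<Rightarrow> real" where
  "mm_seq \<xi> n = mm_next (mm_set \<xi> (n - 1))"

definition transit_time :: "real multiset \<Rightarrow> enat" where
  "transit_time \<xi> =
     (let T = {t. size \<xi> < t \<and> (\<forall>m\<ge>t. mm_seq \<xi> m = mm_seq \<xi> t)}
      in if T = {} then \<infinity> else enat (LEAST t. t \<in> T))"

text \<open>The quotient is taken in the extended reals, so that an infinite transit time gives the
  quotient \<open>\<infinity>\<close> wherever \<open>f\<close> is positive.\<close>

definition transit_time_asymp :: "(nat \<Rightarrow> real multiset) \<Rightarrow> (nat \<Rightarrow> real) \<Rightarrow> bool" where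
  "transit_time_asymp \<Xi> f \<longleftrightarrow>
     (\<lambda>j. ereal_of_enat (transit_time (\<Xi> j)) / ereal (f (size (\<Xi> j)))) \<longlonglongrightarrow> 1"

lemma mm_set_start: "mm_set \<xi> (size \<xi>) = \<xi>"
  by (simp add: mm_set_def)

lemma mm_set_Suc:
  assumes "size \<xi> \<le> n"
  shows "mm_set \<xi> (Suc n) = add_mset (mm_seq \<xi> (Suc n)) (mm_set \<xi> n)"
  using assms by (simp add: mm_set_def mm_seq_def Suc_diff_le mm_step_def)

lemma size_mm_set:
  assumes "size \<xi> \<le> n"
  shows "size (mm_set \<xi> n) = n"
  using assms by (induction n rule: dec_induct) (simp_all add: mm_set_start mm_set_Suc)

lemma mm_seq_Suc:
  assumes "size \<xi> \<le> n"
  shows "mm_seq \<xi> (Suc n) = real (Suc n) * median (mm_set \<xi> n) - sum_mset (mm_set \<xi> n)"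
  using assms by (simp add: mm_seq_def mm_next_def size_mm_set)

end

theory Submission
  imports Defs "HOL-Real_Asymp.Real_Asymp"
begin

text \<open>While the median increases, it traverses the sorted set by half a rank per step, and
  crossing the gap from the element of rank \<open>r\<close> to the next one, of length \<open>g\<close>, creates the two
  numbers at distances \<open>(r + 1/2) g\<close> and \<open>(r + 3/2) g\<close> beyond the left end of the gap. So a block of
  \<open>s\<close> unit gaps starting at rank \<open>r\<close> and position \<open>p\<close> creates a new block of \<open>2s - 1\<close> unit gaps at
  position \<open>p + r + 1/2\<close>: starting from \<open>0, 1, 2\<close> at rank \<open>m\<close>, the blocks double in length. The
  wide gap between consecutive blocks has length about \<open>m\<close>, so the two outliers it creates land beyond
  \<open>m\<^sup>2\<close> and do not interfere before that point. Several copies of a number \<open>Z \<le> m\<^sup>2\<close> stop the median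
  there. Since the blocks contain almost all the integral steps up to \<open>Z\<close>, the rank reached is about
  \<open>m\<^sup>2\<close> when \<open>Z\<close> is close to \<open>m\<^sup>2\<close>, i.e. the time is about \<open>2 m\<^sup>2\<close> for an initial size \<open>2 m - 1\<close>.\<close>

section \<open>Medians of split multisets\<close>

lemma sorted_list_of_multiset_union:
  fixes A B :: "'a::linorder multiset"
  assumes "\<And>x y. x \<in># A \<Longrightarrow> y \<in># B \<Longrightarrow> x \<le> y"
  shows "sorted_list_of_multiset (A + B) = sorted_list_of_multiset A @ sorted_list_of_multiset B"
proof -
  let ?xs = "sorted_list_of_multiset A @ sorted_list_of_multiset B"
  have "sorted ?xs"
    using assms by (simp add: sorted_append)
  then have "sort ?xs = ?xs"
    by (rule sorted_sort_id)
  moreover have "sort ?xs = sorted_list_of_multiset (mset ?xs)"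
    by (simp only: sorted_list_of_multiset_mset)
  ultimately show ?thesis
    by simp
qed

lemma length_sorted_list_of_multiset [simp]: "length (sorted_list_of_multiset A) = size A"
  by (metis mset_sorted_list_of_multiset size_mset)

text \<open>Together with \<open>median_even\<close>, this reads a median off a centre and two
  equally large sides, so that no list index enters the orbit computations.\<close>

lemma median_odd:
  assumes "size A = size B" and "\<And>x. x \<in># A \<Longrightarrow> x \<le> a" and "\<And>x. x \<in># B \<Longrightarrow> a \<le> x"
  shows "median (A + {#a#} + B) = a"
proof -
  have "sorted_list_of_multiset (A + {#a#})
      = sorted_list_of_multiset A @ sorted_list_of_multiset {#a#}"
    by (rule sorted_list_of_multiset_union) (use assms in simp)
  moreover have "sorted_list_of_multiset (A + {#a#} + B)
      = sorted_list_of_multiset (A + {#a#}) @ sorted_list_of_multiset B"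
    by (rule sorted_list_of_multiset_union) (auto intro: assms order_trans[OF assms(2) assms(3)])
  moreover have "sorted_list_of_multiset {#a#} = [a]"
    by simp
  ultimately have "sorted_list_of_multiset (A + {#a#} + B)
      = sorted_list_of_multiset A @ a # sorted_list_of_multiset B"
    by (simp only: append.simps append_assoc)
  moreover have "size (A + {#a#} + B) = Suc (2 * size A)"
    using assms(1) by simp
  ultimately show ?thesis
    by (simp only: median_def Let_def) (simp add: nth_append)
qed

lemma median_even:
  assumes "size A = size B" and "a \<le> b"
    and "\<And>x. x \<in># A \<Longrightarrow> x \<le> a" and "\<And>x. x \<in># B \<Longrightarrow> b \<le> x"
  shows "median (A + {#a#} + {#b#} + B) = (a + b) / 2"
proof -
  have "sorted_list_of_multiset (A + {#a#})
      = sorted_list_of_multiset A @ sorted_list_of_multiset {#a#}"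
    by (rule sorted_list_of_multiset_union) (use assms in simp)
  moreover have "sorted_list_of_multiset (A + {#a#} + {#b#})
      = sorted_list_of_multiset (A + {#a#}) @ sorted_list_of_multiset {#b#}"
    by (rule sorted_list_of_multiset_union) (auto intro: assms order_trans[OF assms(3) assms(2)])
  moreover have "sorted_list_of_multiset (A + {#a#} + {#b#} + B)
      = sorted_list_of_multiset (A + {#a#} + {#b#}) @ sorted_list_of_multiset B"
    by (rule sorted_list_of_multiset_union)
      (auto intro: assms order_trans[OF assms(2) assms(4)]
        order_trans[OF order_trans[OF assms(3) assms(2)] assms(4)])
  moreover have "sorted_list_of_multiset {#a#} = [a]" "sorted_list_of_multiset {#b#} = [b]"
    by simp_all
  ultimately have "sorted_list_of_multiset (A + {#a#} + {#b#} + B)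
      = sorted_list_of_multiset A @ a # b # sorted_list_of_multiset B"
    by (simp only: append.simps append_assoc)
  moreover have "size (A + {#a#} + {#b#} + B) = 2 * Suc (size A)"
    using assms(1) by simp
  ultimately show ?thesis
    by (simp only: median_def Let_def) (simp add: nth_append)
qed

section \<open>General properties of the orbit\<close>

lemma sum_mset_mm_set_Suc:
  assumes "size \<xi> \<le> n"
  shows "sum_mset (mm_set \<xi> (Suc n)) = real (Suc n) * median (mm_set \<xi> n)"
  using assms by (simp add: mm_set_Suc mm_seq_Suc)

lemma mm_set_mm_set:
  assumes "size \<xi> \<le> N" "N \<le> n"
  shows "mm_set (mm_set \<xi> N) n = mm_set \<xi> n"
proof -
  have "mm_set (mm_set \<xi> N) n = (mm_step ^^ (n - N)) ((mm_step ^^ (N - size \<xi>)) \<xi>)"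
    using assms size_mm_set[of \<xi> N] by (simp add: mm_set_def)
  also have "\<dots> = (mm_step ^^ ((n - N) + (N - size \<xi>))) \<xi>"
    by (simp add: funpow_add)
  also have "(n - N) + (N - size \<xi>) = n - size \<xi>"
    using assms by simp
  finally show ?thesis
    by (simp add: mm_set_def)
qed

lemma mm_seq_mm_set:
  assumes "size \<xi> \<le> N" "N < n"
  shows "mm_seq (mm_set \<xi> N) n = mm_seq \<xi> n"
  using assms by (simp add: mm_seq_def mm_set_mm_set)

definition transit_set :: "real multiset \<Rightarrow> nat set" where
  "transit_set \<xi> = {t. size \<xi> < t \<and> (\<forall>m\<ge>t. mm_seq \<xi> m = mm_seq \<xi> t)}"

lemma transit_time_eq_enat_iff:
  "transit_time \<xi> = enat t \<longleftrightarrow> t \<in> transit_set \<xi> \<and> (\<forall>u\<in>transit_set \<xi>. t \<le> u)"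
proof -
  have "transit_time \<xi>
      = (if transit_set \<xi> = {} then \<infinity> else enat (LEAST t. t \<in> transit_set \<xi>))"
    unfolding transit_time_def transit_set_def Let_def ..
  then show ?thesis
    by (metis LeastI Least_le Least_equality enat.distinct(1) enat.inject equals0D all_not_in_conv)
qed

text \<open>Constancy from an earlier time would force the values at \<open>t - 1\<close> and
  \<open>t\<close> to agree. The first premise puts \<open>t - 1\<close> above
  \<open>size \<xi>\<close>, where \<open>mm_seq\<close> is a genuine new number.\<close>

lemma transit_time_eqI:
  assumes "size \<xi> + 1 < t" and "\<And>n. t \<le> n \<Longrightarrow> mm_seq \<xi> n = z" and "mm_seq \<xi> (t - 1) \<noteq> z"
  shows "transit_time \<xi> = enat t"
  unfolding transit_time_eq_enat_iff
proof (intro conjI ballI)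
  show "t \<in> transit_set \<xi>"
    using assms by (simp add: transit_set_def)
  fix u assume u: "u \<in> transit_set \<xi>"
  show "t \<le> u"
  proof (rule ccontr)
    assume "\<not> t \<le> u"
    then have "u \<le> t - 1" "u \<le> t"
      by simp_all
    with u have "mm_seq \<xi> (t - 1) = mm_seq \<xi> t"
      unfolding transit_set_def by (metis (mono_tags, lifting) mem_Collect_eq)
    then show False
      using assms(2)[of t] assms(3) by simp
  qed
qed

text \<open>Time indices are absolute, so restarting an orbit from its stage \<open>N\<close> keeps
  every term after \<open>N\<close> and only discards the times up to \<open>N\<close>.\<close>

lemma transit_set_mm_set:
  assumes "size \<xi> \<le> N"
  shows "transit_set (mm_set \<xi> N) = transit_set \<xi> \<inter> {N<..}"
proof (rule set_eqI)
  fix u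
  have eq: "mm_seq (mm_set \<xi> N) n = mm_seq \<xi> n" if "N < u" "u \<le> n" for n
    using that assms by (simp add: mm_seq_mm_set)
  have size: "size (mm_set \<xi> N) = N"
    using assms by (rule size_mm_set)
  show "u \<in> transit_set (mm_set \<xi> N) \<longleftrightarrow> u \<in> transit_set \<xi> \<inter> {N<..}"
  proof (cases "N < u")
    case True
    have "(\<forall>m\<ge>u. mm_seq (mm_set \<xi> N) m = mm_seq (mm_set \<xi> N) u)
        \<longleftrightarrow> (\<forall>m\<ge>u. mm_seq \<xi> m = mm_seq \<xi> u)"
      using eq[OF True] by (metis order_refl)
    with True assms show ?thesis
      unfolding transit_set_def size Int_iff mem_Collect_eq greaterThan_iff
      by (metis le_less_trans)
  next
    case False
    then show ?thesis
      unfolding transit_set_def size by blast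
  qed
qed

lemma transit_time_mm_set:
  assumes "size \<xi> \<le> N" "N < t" and "transit_time \<xi> = enat t"
  shows "transit_time (mm_set \<xi> N) = enat t"
  using assms unfolding transit_time_eq_enat_iff by (auto simp: transit_set_mm_set)

lemma transit_time_asympI:
  assumes "\<And>j. transit_time (\<Xi> j) = enat (t j)" and "\<And>j. 0 < f (size (\<Xi> j))"
    and "(\<lambda>j. real (t j) / f (size (\<Xi> j))) \<longlonglongrightarrow> 1"
  shows "transit_time_asymp \<Xi> f"
proof -
  have "ereal_of_enat (transit_time (\<Xi> j)) / ereal (f (size (\<Xi> j)))
      = ereal (real (t j) / f (size (\<Xi> j)))" for j
    using assms(1)[of j] assms(2)[of j] by simp
  then show ?thesis
    using assms(3) by (simp add: transit_time_asymp_def one_ereal_def)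
qed

section \<open>Crossing an arithmetic progression\<close>

text \<open>Since \<open>k\<close> counts elements, a block of \<open>s\<close> unit gaps is
  \<open>progression p (s + 1)\<close>.\<close>

definition progression :: "real \<Rightarrow> nat \<Rightarrow> real multiset" where
  "progression p k = image_mset (\<lambda>i. p + real i) (mset [0..<k])"

lemma progression_0 [simp]: "progression p 0 = {#}"
  by (simp add: progression_def)

lemma progression_Suc: "progression p (Suc k) = progression p k + {#p + real k#}"
  by (simp add: progression_def)

lemma size_progression [simp]: "size (progression p k) = k"
  by (simp add: progression_def)

lemma in_progression_iff: "x \<in># progression p k \<longleftrightarrow> (\<exists>i<k. x = p + real i)"
  by (auto simp: progression_def)

lemma progression_add: "progression p (k + l) = progression p k + progression (p + real k) l"
  by (induction l) (simp_all add: progression_Suc algebra_simps)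

text \<open>The sum fixes the mean, which along an orbit is the previous median. Each gap takes two
  steps: the median is first its midpoint, then its right end, and the two new numbers extend a unit
  progression from \<open>p + real \<rho> + 1/2\<close>. As \<open>s \<le> \<rho>\<close>, they fall
  beyond the block and do not disturb the crossing.\<close>

lemma progression_crossing:
  assumes "size \<xi> \<le> 2 * \<rho>"
    and set: "mm_set \<xi> (2 * \<rho>) = A + progression p (s + 1) + C"
    and A: "size A + 1 = \<rho>" "\<And>x. x \<in># A \<Longrightarrow> x \<le> p"
    and C: "\<And>x. x \<in># C \<Longrightarrow> p + real s \<le> x"
    and sum: "sum_mset (mm_set \<xi> (2 * \<rho>)) = real (2 * \<rho>) * p"
    and "s \<le> \<rho>" "t \<le> s"
  shows "mm_set \<xi> (2 * (\<rho> + t))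
      = A + progression p (s + 1) + progression (p + real \<rho> + 1/2) (2 * t) + C
    \<and> sum_mset (mm_set \<xi> (2 * (\<rho> + t))) = real (2 * (\<rho> + t)) * (p + real t)"
  using \<open>t \<le> s\<close>
proof (induction t)
  case 0
  then show ?case
    using set sum by simp
next
  case (Suc t)
  let ?n = "2 * (\<rho> + t)" and ?q = "p + real \<rho> + 1/2"
  let ?N = "progression ?q (2 * t)"
  have set: "mm_set \<xi> ?n = A + progression p (s + 1) + ?N + C"
    and sum: "sum_mset (mm_set \<xi> ?n) = real ?n * (p + real t)"
    using Suc by auto
  have n: "size \<xi> \<le> ?n"
    using assms(1) by simp
  define l where "l = s - Suc t"
  \<comment> \<open>The cut isolates the two ends of the gap now at the centre from the
    \<open>t\<close> points passed and the \<open>l\<close> points ahead.\<close>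
  have s: "s + 1 = t + 1 + (1 + l)"
    using Suc.prems l_def by simp
  have block: "progression p (s + 1) = progression p t + {#p + real t#}
      + ({#p + real t + 1#} + progression (p + real t + 2) l)"
    unfolding s progression_add by (simp add: progression_Suc algebra_simps)
  let ?A = "A + progression p t" and ?B = "progression (p + real t + 2) l + ?N + C"
  have A': "x \<le> p + real t" if "x \<in># ?A" for x
    using that A(2) by (force simp: in_progression_iff)
  have B': "p + real t + 1 \<le> x" if "x \<in># ?B" for x
    using that C \<open>s \<le> \<rho>\<close> Suc.prems by (force simp: in_progression_iff)
  \<comment> \<open>Hence \<open>?A\<close> and \<open>?B\<close>, the two sides of the central
    pair, both have \<open>\<rho> + t - 1\<close> elements.\<close>
  have size: "size C + s = \<rho>"
    using size_mm_set[OF n] A(1) unfolding set by simp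
  have set1: "mm_set \<xi> ?n = ?A + {#p + real t#} + {#p + real t + 1#} + ?B"
    unfolding set block by (simp add: ac_simps)
  have med1: "median (mm_set \<xi> ?n) = p + real t + 1/2"
    unfolding set1
  proof (subst median_even)
    show "size ?A = size ?B"
      using size A(1) Suc.prems by (simp add: l_def)
  qed (use A' B' in auto)
  have x1: "mm_seq \<xi> (Suc ?n) = ?q + real (2 * t)"
    unfolding mm_seq_Suc[OF n] med1 sum by (simp add: field_simps)
  have set2: "mm_set \<xi> (Suc ?n) = (?A + {#p + real t#}) + {#p + real t + 1#}
      + (?B + {#?q + real (2 * t)#})"
    unfolding mm_set_Suc[OF n] x1 set1 by (simp add: ac_simps)
  have med2: "median (mm_set \<xi> (Suc ?n)) = p + real t + 1"
    unfolding set2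
  proof (rule median_odd)
    show "size (?A + {#p + real t#}) = size (?B + {#?q + real (2 * t)#})"
      using size A(1) Suc.prems by (simp add: l_def)
    show "p + real t + 1 \<le> x" if "x \<in># ?B + {#?q + real (2 * t)#}" for x
      using that B' \<open>s \<le> \<rho>\<close> Suc.prems by force
  qed (use A' in force)
  have n1: "size \<xi> \<le> Suc ?n"
    using n by simp
  have x2: "mm_seq \<xi> (Suc (Suc ?n)) = ?q + real (2 * t + 1)"
    unfolding mm_seq_Suc[OF n1] sum_mset_mm_set_Suc[OF n] med1 med2 by (simp add: field_simps)
  have n2: "2 * (\<rho> + Suc t) = Suc (Suc ?n)"
    by simp
  have "mm_set \<xi> (Suc (Suc ?n))
      = A + progression p (s + 1) + (?N + {#?q + real (2 * t)#} + {#?q + real (2 * t + 1)#}) + C"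
    unfolding mm_set_Suc[OF n1] mm_set_Suc[OF n] x1 x2 set by (simp add: ac_simps)
  also have "?N + {#?q + real (2 * t)#} + {#?q + real (2 * t + 1)#}
      = progression ?q (2 * Suc t)"
    by (simp add: progression_Suc)
  finally show ?case
    using sum_mset_mm_set_Suc[OF n1] unfolding n2 med2 by simp
qed

section \<open>Doubling blocks of unit gaps\<close>

text \<open>Rank, counted from 1, of the first point of block \<open>j\<close>, which has
  \<open>2 ^ j + 2\<close> points. That point is the lower central element at time
  \<open>2 * block_rank m j\<close>.\<close>

fun block_rank :: "nat \<Rightarrow> nat \<Rightarrow> nat" where
  "block_rank m 0 = m"
| "block_rank m (Suc j) = block_rank m j + 2 ^ j + 2"

fun block_pos :: "nat \<Rightarrow> nat \<Rightarrow> real" where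
  "block_pos m 0 = 0"
| "block_pos m (Suc j) = block_pos m j + real (block_rank m j) + 1/2"

lemma block_rank_eq: "real (block_rank m j) = real m + 2 ^ j + 2 * real j - 1"
  by (induction j) simp_all

lemma block_pos_eq:
  "block_pos m j = real j * real m + 2 ^ j - 1 + (real j)\<^sup>2 - 3/2 * real j"
  by (induction j) (simp_all add: block_rank_eq power2_eq_square field_simps)

lemma block_pos_nonneg: "0 \<le> block_pos m j"
  by (induction j) simp_all

lemma le_block_rank: "m \<le> block_rank m j"
  by (induction j) simp_all

text \<open>The condition on the sum records that the previous median was the start of block \<open>j\<close>.\<close>

definition block_state :: "real multiset \<Rightarrow> nat \<Rightarrow> real \<Rightarrow> nat \<Rightarrow> bool" where
  "block_state \<xi> m Z j \<longleftrightarrow> size \<xi> \<le> 2 * block_rank m j \<and>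
    sum_mset (mm_set \<xi> (2 * block_rank m j)) = real (2 * block_rank m j) * block_pos m j \<and>
    (\<exists>A C. mm_set \<xi> (2 * block_rank m j) = A + progression (block_pos m j) (2 ^ j + 2) + C \<and>
      size A + 1 = block_rank m j \<and> (\<forall>x\<in>#A. x \<le> block_pos m j) \<and>
      Z \<in># C \<and> (\<forall>x\<in>#C. Z \<le> x))"

text \<open>Crossing the \<open>2 ^ j + 1\<close> gaps of block \<open>j\<close> creates block
  \<open>j + 1\<close>; two more steps cross the wide gap between them. The bound
  \<open>Z \<le> m^2\<close> sends both resulting outliers to the upper part. The second conclusion
  will show that the orbit is not yet constant at that time.\<close>

lemma block_state_Suc:
  assumes state: "block_state \<xi> m Z j"
    and Z: "block_pos m (Suc j) \<le> Z" "Z \<le> (real m)\<^sup>2" and m: "2 \<le> m"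
  shows "block_state \<xi> m Z (Suc j) \<and> Z < mm_seq \<xi> (2 * block_rank m (Suc j))"
proof -
  \<comment> \<open>Here \<open>s\<close> counts the gaps of block \<open>j\<close>,
    \<open>q\<close> is its last point, \<open>p'\<close> the first point of the next block, and
    \<open>h\<close> the wide gap between them.\<close>
  define r p s where "r = block_rank m j" and "p = block_pos m j" and "s = (2::nat) ^ j + 1"
  define q p' \<rho> where "q = p + real s" and "p' = p + real r + 1/2" and "\<rho> = r + s"
  define h where "h = p' - q"
  have s: "s + 1 = 2 ^ j + 2"
    by (simp add: s_def)
  from state[unfolded block_state_def, folded r_def p_def s] obtain A C where size: "size \<xi> \<le> 2 * r"
    and sum0: "sum_mset (mm_set \<xi> (2 * r)) = real (2 * r) * p"
    and set0: "mm_set \<xi> (2 * r) = A + progression p (s + 1) + C"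
    and A: "size A + 1 = r" "\<And>x. x \<in># A \<Longrightarrow> x \<le> p"
    and C: "Z \<in># C" "\<And>x. x \<in># C \<Longrightarrow> Z \<le> x"
    by blast
  have r: "real r = real m + 2 ^ j + 2 * real j - 1"
    unfolding r_def by (rule block_rank_eq)
  have h: "h = real m + 2 * real j - 3/2"
    by (simp add: h_def p'_def q_def s_def r)
  have h0: "0 < h"
    using m by (simp add: h)
  have p'Z: "p' \<le> Z"
    using Z(1) by (simp add: p'_def p_def r_def)
  have "real s \<le> real r"
    using m unfolding r by (simp add: s_def)
  then have "s \<le> r"
    by (rule of_nat_le_iff[THEN iffD1])
  have "p + real s \<le> x" if "x \<in># C" for x
    using C(2)[OF that] p'Z h0 by (simp add: h_def q_def)
  from progression_crossing[OF size set0 A this sum0 \<open>s \<le> r\<close> order_refl]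
  have set: "mm_set \<xi> (2 * \<rho>) = A + progression p (s + 1) + progression p' (2 * s) + C"
    and sum: "sum_mset (mm_set \<xi> (2 * \<rho>)) = real (2 * \<rho>) * q"
    unfolding \<rho>_def p'_def q_def by blast+
  have n: "size \<xi> \<le> 2 * \<rho>"
    using size by (simp add: \<rho>_def)
  have block: "progression p (s + 1) = progression p s + {#q#}"
    by (simp add: progression_Suc q_def)
  have "2 * s = 1 + (2 * s - 1)"
    by (simp add: s_def)
  then have block': "progression p' (2 * s) = {#p'#} + progression (p' + 1) (2 * s - 1)"
    using progression_add[of p' 1 "2 * s - 1"] by (simp add: progression_Suc)
  let ?A = "A + progression p s" and ?B = "progression (p' + 1) (2 * s - 1) + C"
  have set1: "mm_set \<xi> (2 * \<rho>) = ?A + {#q#} + {#p'#} + ?B"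
    unfolding set block block' by (simp add: ac_simps)
  have sizes: "size ?A = size ?B"
    using size_mm_set[OF n] A(1) unfolding set1 by (simp add: \<rho>_def)
  have A': "x \<le> q" if "x \<in># ?A" for x
    using that A(2) by (force simp: in_progression_iff q_def)
  have B': "p' \<le> x" if "x \<in># ?B" for x
    using that C(2) p'Z by (force simp: in_progression_iff)
  have "q \<le> p'"
    using h0 by (simp add: h_def)
  have med1: "median (mm_set \<xi> (2 * \<rho>)) = (q + p') / 2"
    unfolding set1 by (rule median_even[OF sizes \<open>q \<le> p'\<close> A' B'])
  define x1 x2 where "x1 = q + (real \<rho> + 1/2) * h" and "x2 = x1 + h"
  have x1: "mm_seq \<xi> (Suc (2 * \<rho>)) = x1"
    unfolding mm_seq_Suc[OF n] med1 sum by (simp add: x1_def h_def field_simps)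
  \<comment> \<open>The lower bounds for \<open>\<rho> + 1/2\<close>, \<open>h\<close> and
    \<open>q\<close> are their values at \<open>j = 0\<close>. They give
    \<open>x1 \<ge> m^2 + m - 7/4\<close>, which is at least \<open>m^2\<close>.\<close>
  have "Z \<le> x1"
  proof -
    have pow: "(1::real) \<le> 2 ^ j"
      by simp
    then have "real m + 5/2 \<le> real \<rho> + 1/2" "real m - 3/2 \<le> h"
      unfolding h \<rho>_def s_def of_nat_add r of_nat_power of_nat_numeral of_nat_1
      using of_nat_0_le_iff[of j, where 'a = real] by linarith+
    then have "(real m + 5/2) * (real m - 3/2) \<le> (real \<rho> + 1/2) * h"
      using m by (intro mult_mono) simp_all
    moreover have "2 \<le> q"
      unfolding q_def p_def s_def of_nat_add of_nat_power of_nat_numeral of_nat_1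
      using block_pos_nonneg[of m j] pow by linarith
    moreover have "(real m)\<^sup>2 \<le> 2 + (real m + 5/2) * (real m - 3/2)"
      using m by (simp add: power2_eq_square algebra_simps)
    ultimately show ?thesis
      using Z(2) by (simp add: x1_def)
  qed
  have set2: "mm_set \<xi> (Suc (2 * \<rho>)) = (?A + {#q#}) + {#p'#} + (?B + {#x1#})"
    unfolding mm_set_Suc[OF n] x1 set1 by (simp add: ac_simps)
  have med2: "median (mm_set \<xi> (Suc (2 * \<rho>))) = p'"
    unfolding set2
  proof (rule median_odd)
    show "size (?A + {#q#}) = size (?B + {#x1#})"
      using sizes by simp
    show "x \<le> p'" if "x \<in># ?A + {#q#}" for x
      using that A' \<open>q \<le> p'\<close> by force
    show "p' \<le> x" if "x \<in># ?B + {#x1#}" for x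
      using that B' \<open>Z \<le> x1\<close> p'Z by force
  qed
  have n1: "size \<xi> \<le> Suc (2 * \<rho>)"
    using n by simp
  have x2: "mm_seq \<xi> (Suc (Suc (2 * \<rho>))) = x2"
    unfolding mm_seq_Suc[OF n1] sum_mset_mm_set_Suc[OF n] med1 med2
    by (simp add: x2_def x1_def h_def field_simps)
  have r': "2 * block_rank m (Suc j) = Suc (Suc (2 * \<rho>))"
    by (simp add: \<rho>_def r_def s_def)
  have p': "block_pos m (Suc j) = p'"
    by (simp add: p'_def p_def r_def)
  \<comment> \<open>Block \<open>j\<close> joins the lower part, the outliers \<open>x1\<close> and
    \<open>x2\<close> the upper part.\<close>
  have "mm_set \<xi> (Suc (Suc (2 * \<rho>)))
      = (A + progression p (s + 1)) + progression p' (2 ^ Suc j + 2) + (C + {#x1#} + {#x2#})"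
    unfolding mm_set_Suc[OF n1] mm_set_Suc[OF n] x1 x2 set by (simp add: s_def ac_simps)
  moreover have "size (A + progression p (s + 1)) + 1 = block_rank m (Suc j)"
    using A(1) by (simp add: r_def s_def)
  moreover have "\<forall>x\<in>#A + progression p (s + 1). x \<le> p'"
    unfolding block using A' \<open>q \<le> p'\<close> by force
  moreover have "Z \<in># C + {#x1#} + {#x2#}" "\<forall>x\<in>#C + {#x1#} + {#x2#}. Z \<le> x"
    using C \<open>Z \<le> x1\<close> h0 by (auto simp: x2_def)
  ultimately have "block_state \<xi> m Z (Suc j)"
    unfolding block_state_def r' p' sum_mset_mm_set_Suc[OF n1] med2
    using le_SucI[OF n1] by blast
  moreover have "Z < mm_seq \<xi> (2 * block_rank m (Suc j))"
    unfolding r' x2 using \<open>Z \<le> x1\<close> h0 by (simp add: x2_def)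
  ultimately show ?thesis ..
qed

section \<open>Stabilisation at a repeated value\<close>

lemma median_replicate_mset:
  assumes "size A = size B" "0 < k"
    and "\<And>x. x \<in># A \<Longrightarrow> x \<le> z" and "\<And>x. x \<in># B \<Longrightarrow> z \<le> x"
  shows "median (A + replicate_mset k z + B) = z"
proof (cases "even k")
  case True
  then obtain l where "k = 2 * Suc l"
    using \<open>0 < k\<close> by (metis evenE gr0_conv_Suc mult_0_right neq0_conv)
  then have k: "k = l + 2 + l"
    by simp
  have "A + replicate_mset k z + B
      = (A + replicate_mset l z) + {#z#} + {#z#} + (B + replicate_mset l z)"
    by (rule multiset_eqI) (simp add: k)
  also have "median \<dots> = (z + z) / 2"
    by (rule median_even) (use assms in \<open>auto split: if_splits\<close>)
  finally show ?thesis
    by simp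
next
  case False
  then obtain l where k: "k = l + 1 + l"
    by (metis add.commute add.left_commute mult_2 oddE)
  have "A + replicate_mset k z + B
      = (A + replicate_mset l z) + {#z#} + (B + replicate_mset l z)"
    by (rule multiset_eqI) (simp add: k)
  also have "median \<dots> = z"
    by (rule median_odd) (use assms in \<open>auto split: if_splits\<close>)
  finally show ?thesis .
qed

text \<open>When mean and median are both \<open>z\<close>, the next number is
  \<open>(n + 1) z - n z = z\<close>, and adjoining it changes neither.\<close>

lemma mm_seq_const:
  assumes "size \<xi> \<le> n" and "sum_mset (mm_set \<xi> n) = real n * z"
    and "mm_set \<xi> n = A + replicate_mset k z + B" and "size A = size B" "0 < k"
    and "\<And>x. x \<in># A \<Longrightarrow> x \<le> z" and "\<And>x. x \<in># B \<Longrightarrow> z \<le> x"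
  shows "mm_seq \<xi> (Suc (n + i)) = z"
proof -
  have "mm_set \<xi> (n + i) = A + replicate_mset (k + i) z + B
      \<and> sum_mset (mm_set \<xi> (n + i)) = real (n + i) * z \<and> mm_seq \<xi> (Suc (n + i)) = z"
  proof (induction i)
    case 0
    have "median (mm_set \<xi> n) = z"
      unfolding assms(3) using assms(4-) by (rule median_replicate_mset)
    with assms(1-3) show ?case
      by (simp add: mm_seq_Suc algebra_simps)
  next
    case (Suc i)
    have n: "size \<xi> \<le> n + i" "size \<xi> \<le> Suc (n + i)"
      using assms(1) by simp_all
    have set: "mm_set \<xi> (Suc (n + i)) = A + replicate_mset (Suc (k + i)) z + B"
      using Suc mm_set_Suc[OF n(1)] by simp
    have "sum_mset (mm_set \<xi> (Suc (n + i)))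
        = mm_seq \<xi> (Suc (n + i)) + sum_mset (mm_set \<xi> (n + i))"
      by (simp add: mm_set_Suc[OF n(1)])
    moreover have "sum_mset (mm_set \<xi> (n + i)) = real (n + i) * z" "mm_seq \<xi> (Suc (n + i)) = z"
      using Suc by blast+
    ultimately have sum: "sum_mset (mm_set \<xi> (Suc (n + i))) = real (Suc (n + i)) * z"
      by (simp add: algebra_simps)
    have "median (mm_set \<xi> (Suc (n + i))) = z"
      unfolding set using assms(4-) by (intro median_replicate_mset) simp_all
    then have "mm_seq \<xi> (Suc (Suc (n + i))) = z"
      unfolding mm_seq_Suc[OF n(2)] sum by (simp add: algebra_simps)
    with set sum show ?case
      by simp
  qed
  then show ?thesis
    by simp
qed

text \<open>The stopping value now is the start of block \<open>j\<close>: one copy from the block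
  and one from the upper part form the central pair, and the mean has the same value.\<close>

lemma mm_seq_after_block_state:
  assumes "block_state \<xi> m (block_pos m j) j" "2 * block_rank m j < n"
  shows "mm_seq \<xi> n = block_pos m j"
proof -
  define r Z where "r = block_rank m j" and "Z = block_pos m j"
  from assms(1)[unfolded block_state_def, folded r_def Z_def] obtain A C where size: "size \<xi> \<le> 2 * r"
    and sum: "sum_mset (mm_set \<xi> (2 * r)) = real (2 * r) * Z"
    and set: "mm_set \<xi> (2 * r) = A + progression Z (2 ^ j + 2) + C"
    and A: "size A + 1 = r" "\<And>x. x \<in># A \<Longrightarrow> x \<le> Z"
    and C: "Z \<in># C" "\<And>x. x \<in># C \<Longrightarrow> Z \<le> x"
    by blast
  obtain C' where C': "C = add_mset Z C'"
    using C(1) by (metis mset_add)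
  have "progression Z (2 ^ j + 2) = {#Z#} + progression (Z + 1) (2 ^ j + 1)"
    using progression_add[of Z 1 "2 ^ j + 1"] by (simp add: progression_Suc)
  then have set': "mm_set \<xi> (2 * r)
      = A + replicate_mset 2 Z + (progression (Z + 1) (2 ^ j + 1) + C')"
    unfolding set C' by (simp add: numeral_2_eq_2)
  have "size A = size (progression (Z + 1) (2 ^ j + 1) + C')"
    using size_mm_set[OF size] A(1) unfolding set' by simp
  moreover have "Z \<le> x" if "x \<in># progression (Z + 1) (2 ^ j + 1) + C'" for x
    using that C(2) by (force simp: C' in_progression_iff)
  ultimately have "mm_seq \<xi> (Suc (2 * r + (n - Suc (2 * r)))) = Z"
    using A(2) by (intro mm_seq_const[OF size sum set']) simp_all
  then show ?thesis
    using assms(2) by (simp add: r_def Z_def)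
qed

section \<open>Initial sets and their transit time\<close>

text \<open>The low value is chosen so that the first new number is \<open>Z\<close> again.\<close>

definition initial_set :: "nat \<Rightarrow> real \<Rightarrow> real multiset" where
  "initial_set m Z = replicate_mset (m - 1) (- (((real m - 2) * Z + 3) / (real m - 1)))
    + {#0, 1, 2#} + replicate_mset (m - 3) Z"

lemma size_initial_set: "3 \<le> m \<Longrightarrow> size (initial_set m Z) = 2 * m - 1"
  by (simp add: initial_set_def)

text \<open>Median 0 and sum \<open>- Z\<close> make \<open>Z\<close> the first new number and bring
  the sum to 0, as required for block 0 at position 0.\<close>

lemma block_state_initial_set:
  assumes "3 \<le> m" "2 \<le> Z"
  shows "block_state (initial_set m Z) m Z 0"
proof -
  let ?\<xi> = "initial_set m Z" and ?w = "- (((real m - 2) * Z + 3) / (real m - 1))"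
  have w: "?w \<le> 0"
    using assms by simp
  have "?\<xi> = replicate_mset (m - 1) ?w + {#0#} + ({#1, 2#} + replicate_mset (m - 3) Z)"
    by (simp add: initial_set_def)
  also have "median \<dots> = 0"
    by (rule median_odd) (use assms w in \<open>auto split: if_splits\<close>)
  finally have med: "median ?\<xi> = 0" .
  have "real (m - 1) * ?w = - ((real m - 2) * Z + 3)"
    using assms by (simp add: of_nat_diff)
  moreover have "sum_mset ?\<xi> = real (m - 1) * ?w + 3 + real (m - 3) * Z"
    by (simp add: initial_set_def)
  ultimately have "sum_mset ?\<xi> = - ((real m - 2) * Z + 3) + 3 + real (m - 3) * Z"
    by (simp only:)
  then have "sum_mset ?\<xi> = - Z"
    using assms by (simp add: of_nat_diff algebra_simps)
  moreover have n: "size ?\<xi> \<le> 2 * m - 1" "Suc (2 * m - 1) = 2 * m"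
    using assms by (simp_all add: size_initial_set)
  moreover have start: "mm_set ?\<xi> (2 * m - 1) = ?\<xi>"
    using assms mm_set_start[of ?\<xi>] by (simp add: size_initial_set)
  ultimately have "mm_seq ?\<xi> (2 * m) = Z"
    using mm_seq_Suc[OF n(1)] med by simp
  then have "mm_set ?\<xi> (2 * m) = replicate_mset (m - 1) ?w + progression 0 (2 ^ 0 + 2)
      + add_mset Z (replicate_mset (m - 3) Z)"
    using mm_set_Suc[OF n(1)] n(2) start
    by (simp add: initial_set_def numeral_3_eq_3 progression_Suc)
  moreover have "sum_mset (mm_set ?\<xi> (2 * m)) = 0"
    using sum_mset_mm_set_Suc[OF n(1)] n(2) start med by simp
  moreover have "size (replicate_mset (m - 1) ?w) + 1 = m"
    using assms by simp
  moreover have "\<forall>x\<in>#replicate_mset (m - 1) ?w. x \<le> 0"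
    using w by auto
  moreover have "\<forall>x\<in>#add_mset Z (replicate_mset (m - 3) Z). Z \<le> x"
    by auto
  moreover have "Z \<in># add_mset Z (replicate_mset (m - 3) Z)"
    by simp
  ultimately show ?thesis
    using assms(1) unfolding block_state_def block_rank.simps block_pos.simps
    by (intro conjI exI[of _ "replicate_mset (m - 1) ?w"]
        exI[of _ "add_mset Z (replicate_mset (m - 3) Z)"]) (simp_all add: size_initial_set)
qed

lemma block_pos_mono: "i \<le> j \<Longrightarrow> block_pos m i \<le> block_pos m j"
  by (rule lift_Suc_mono_le) simp_all

text \<open>The states succeed one another up to \<open>J\<close>, where the orbit becomes constant.
  The time is exact because the number just before, the second outlier of the last wide gap, exceeds
  the limit; \<open>1 \<le> J\<close> provides such a gap.\<close>

lemma transit_time_initial_set: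
  assumes m: "3 \<le> m" and J: "1 \<le> J" and le: "block_pos m J \<le> (real m)\<^sup>2"
  shows "transit_time (initial_set m (block_pos m J)) = enat (2 * block_rank m J + 1)"
proof -
  let ?Z = "block_pos m J"
  let ?\<xi> = "initial_set m ?Z"
  have "2 \<le> block_pos m 1"
    using m by simp
  also have "block_pos m 1 \<le> ?Z"
    using J by (rule block_pos_mono)
  finally have state0: "block_state ?\<xi> m ?Z 0"
    using m by (intro block_state_initial_set)
  have states: "block_state ?\<xi> m ?Z j" if "j \<le> J" for j
    using that
  proof (induction j)
    case (Suc j)
    then show ?case
      using block_state_Suc[of ?\<xi> m ?Z j] block_pos_mono[of "Suc j" J m] m le by simp
  qed (rule state0)
  obtain j where j: "J = Suc j"
    using J by (cases J) auto
  show ?thesis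
  proof (rule transit_time_eqI)
    show "mm_seq ?\<xi> n = ?Z" if "2 * block_rank m J + 1 \<le> n" for n
      using that states[of J] by (intro mm_seq_after_block_state) simp_all
    have "?Z < mm_seq ?\<xi> (2 * block_rank m J)"
      using block_state_Suc[of ?\<xi> m ?Z j] states[of j] m le by (simp add: j)
    then show "mm_seq ?\<xi> (2 * block_rank m J + 1 - 1) \<noteq> ?Z"
      by simp
    show "size ?\<xi> + 1 < 2 * block_rank m J + 1"
      using le_block_rank[of m J] m by (simp add: size_initial_set)
  qed
qed

section \<open>Asymptotics\<close>

text \<open>With \<open>2 * i\<close> blocks the rank is dominated by
  \<open>2 ^ (2 * i) = 4 ^ i\<close>, about \<open>m^2\<close> for \<open>m = 2 ^ i + 4 * i\<close>;
  the summand \<open>4 * i\<close> makes room for the lower-order terms of the position.\<close>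

lemma transit_time_quadratic_family:
  fixes i :: nat
  assumes i: "1 \<le> i"
  defines "\<xi> \<equiv> initial_set (2 ^ i + 4 * i) (block_pos (2 ^ i + 4 * i) (2 * i))"
  shows "size \<xi> = 2 * (2 ^ i + 4 * i) - 1"
    and "transit_time \<xi> = enat (2 * 4 ^ i + 2 * 2 ^ i + 16 * i - 1)"
proof -
  define m :: nat where "m = 2 ^ i + 4 * i"
  have m: "3 \<le> m"
    using i by (simp add: m_def)
  then show "size \<xi> = 2 * (2 ^ i + 4 * i) - 1"
    unfolding \<xi>_def m_def by (rule size_initial_set)
  have pow: "(2::real) ^ (i * 2) = 2 ^ i * 2 ^ i"
    by (simp add: power_mult power2_eq_square)
  \<comment> \<open>The sides are \<open>4^i + 2 i 2^i + 12 i^2 - 3 i - 1\<close> and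
    \<open>4^i + 8 i 2^i + 16 i^2\<close>.\<close>
  have "block_pos m (2 * i) \<le> (real m)\<^sup>2"
    by (simp add: block_pos_eq m_def pow power2_eq_square algebra_simps add_increasing)
  with m i have "transit_time \<xi> = enat (2 * block_rank m (2 * i) + 1)"
    unfolding \<xi>_def m_def[symmetric] by (intro transit_time_initial_set) simp_all
  also have "2 * block_rank m (2 * i) + 1 = 2 * 4 ^ i + 2 * 2 ^ i + 16 * i - 1"
  proof -
    have "real (block_rank m (2 * i) + 1) = real (m + 2 ^ (2 * i) + 4 * i)"
      by (simp add: block_rank_eq)
    then have "block_rank m (2 * i) + 1 = m + 2 ^ (2 * i) + 4 * i"
      by (rule of_nat_eq_iff[THEN iffD1])
    then show ?thesis
      by (simp add: m_def power_mult)
  qed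
  finally show "transit_time \<xi> = enat (2 * 4 ^ i + 2 * 2 ^ i + 16 * i - 1)" .
qed

text \<open>Every member of an orbit before its transit time is itself an initial set with the same
  transit time; so a family whose transit time is superlinear in the size yields, by starting late,
  families with any prescribed linear growth rate.\<close>

lemma transit_time_asymp_linear:
  fixes \<Xi> :: "nat \<Rightarrow> real multiset" and t :: "nat \<Rightarrow> nat" and c :: real
  assumes c: "1 < c" "c \<le> d"
    and t: "\<And>j. transit_time (\<Xi> j) = enat (t j)"
    and size: "\<And>j. \<Xi> j \<noteq> {#}" "\<And>j. d * (real (size (\<Xi> j)) + 1) \<le> real (t j)"
    and growth: "\<And>j. real (t j) + d \<le> real (t (Suc j))"
  shows "\<exists>\<Xi>' :: nat \<Rightarrow> real multiset. (\<forall>j. \<Xi>' j \<noteq> {#}) \<and> strict_mono (\<lambda>j. size (\<Xi>' j))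
    \<and> transit_time_asymp \<Xi>' (\<lambda>n. c * real n)"
proof -
  \<comment> \<open>Restart time, chosen so that \<open>c * N j\<close> is within \<open>c\<close>
    of \<open>t j\<close>.\<close>
  define N where "N j = nat \<lfloor>real (t j) / c\<rfloor>" for j
  have N: "real (N j) \<le> real (t j) / c" "real (t j) / c < real (N j) + 1" for j
    using c by (simp_all add: N_def of_nat_nat)
  have le_N: "size (\<Xi> j) \<le> N j" for j
  proof -
    have "c * (real (size (\<Xi> j)) + 1) \<le> real (t j)"
      using c by (intro order_trans[OF mult_right_mono size(2)]) simp_all
    then have "real (size (\<Xi> j)) + 1 \<le> real (t j) / c"
      using c by (simp add: field_simps)
    with N(2)[of j] show ?thesis
      by simp
  qed
  have pos: "0 < size (\<Xi> j)" for j
    using size(1) by (simp add: nonempty_has_size)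
  have N_pos: "0 < N j" for j
    using pos[of j] le_N[of j] by simp
  have N_less: "N j < t j" for j
  proof -
    have "real (N j) * 1 < real (N j) * c"
      using c N_pos[of j] by (intro mult_strict_left_mono) simp_all
    also have "\<dots> \<le> real (t j)"
      using N(1)[of j] c by (simp add: field_simps)
    finally show ?thesis
      by simp
  qed
  \<comment> \<open>Growth of \<open>t\<close> by at least \<open>c\<close> raises the quotient by
    at least 1, hence also its floor.\<close>
  have "N j < N (Suc j)" for j
  proof -
    have "real (t j) / c + 1 = (real (t j) + c) / c"
      using c by (simp add: field_simps)
    also have "\<dots> \<le> real (t (Suc j)) / c"
      using c growth[of j] by (intro divide_right_mono) simp_all
    finally show ?thesis
      using N(1)[of j] N(2)[of "Suc j"] by simp
  qed
  then have mono: "strict_mono N"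
    by (simp add: strict_mono_Suc_iff)
  have size': "size (mm_set (\<Xi> j) (N j)) = N j" for j
    using le_N by (rule size_mm_set)
  have lim_N: "filterlim (\<lambda>j. real (N j)) at_top sequentially"
    using filterlim_compose[OF filterlim_real_sequentially filterlim_subseq[OF mono]] .
  have lim: "(\<lambda>j. real (t j) / (c * real (N j))) \<longlonglongrightarrow> 1"
  proof (rule tendsto_sandwich)
    show "\<forall>\<^sub>F j in sequentially. 1 \<le> real (t j) / (c * real (N j))"
      using N(1) N_pos c by (intro always_eventually allI) (simp add: field_simps)
    show "\<forall>\<^sub>F j in sequentially. real (t j) / (c * real (N j)) \<le> 1 + 1 / real (N j)"
    proof (intro always_eventually allI)
      fix j
      have "real (t j) \<le> c * (real (N j) + 1)"
        using N(2)[of j] c by (simp add: field_simps)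
      then have "real (t j) / (c * real (N j)) \<le> c * (real (N j) + 1) / (c * real (N j))"
        using c by (intro divide_right_mono) simp_all
      also have "\<dots> = 1 + 1 / real (N j)"
        using c N_pos[of j] by (simp add: field_simps)
      finally show "real (t j) / (c * real (N j)) \<le> 1 + 1 / real (N j)" .
    qed
    show "(\<lambda>j. 1 + 1 / real (N j)) \<longlonglongrightarrow> 1"
      using tendsto_add[OF tendsto_const[of 1] tendsto_divide_0[OF tendsto_const[of 1]
            filterlim_at_top_imp_at_infinity[OF lim_N]]] by simp
  qed simp
  have "transit_time_asymp (\<lambda>j. mm_set (\<Xi> j) (N j)) (\<lambda>n. c * real n)"
  proof (rule transit_time_asympI)
    show "transit_time (mm_set (\<Xi> j) (N j)) = enat (t j)" for j
      using le_N N_less t by (rule transit_time_mm_set)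
    show "0 < c * real (size (mm_set (\<Xi> j) (N j)))" for j
      using c N_pos[of j] by (simp add: size')
    show "(\<lambda>j. real (t j) / (c * real (size (mm_set (\<Xi> j) (N j))))) \<longlonglongrightarrow> 1"
      using lim by (simp add: size')
  qed
  moreover have "mm_set (\<Xi> j) (N j) \<noteq> {#}" for j
    using size'[of j] N_pos[of j] by (metis size_empty less_irrefl)
  ultimately show ?thesis
    using mono size' by (intro exI[of _ "\<lambda>j. mm_set (\<Xi> j) (N j)"]) simp
qed

theorem mainTheorem1:
  shows "(\<forall>k::nat. \<exists>\<Xi> :: nat \<Rightarrow> real multiset.
            (\<forall>j. \<Xi> j \<noteq> {#}) \<and> strict_mono (\<lambda>j. size (\<Xi> j)) \<and>
            transit_time_asymp \<Xi> (\<lambda>n. sqrt ((3 * real k + 5) / (real k + 1)) * real n)) \<and>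
         (\<exists>\<Xi> :: nat \<Rightarrow> real multiset.
            (\<forall>j. \<Xi> j \<noteq> {#}) \<and> strict_mono (\<lambda>j. size (\<Xi> j)) \<and>
            transit_time_asymp \<Xi> (\<lambda>n. (real n)\<^sup>2 / 2))"
proof -
  \<comment> \<open>The shift by 3 makes \<open>3 * (size + 1) \<le> t\<close> hold from the start;
    at \<open>i = 2\<close> it still fails, with 72 against 71.\<close>
  define \<Xi> where "\<Xi> j = initial_set (2 ^ (j + 3) + 4 * (j + 3))
      (block_pos (2 ^ (j + 3) + 4 * (j + 3)) (2 * (j + 3)))" for j
  define t :: "nat \<Rightarrow> nat" where "t j = 2 * 4 ^ (j + 3) + 2 * 2 ^ (j + 3) + 16 * (j + 3) - 1" for j
  have size: "size (\<Xi> j) = 2 * (2 ^ (j + 3) + 4 * (j + 3)) - 1"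
    and transit: "transit_time (\<Xi> j) = enat (t j)" for j
    using transit_time_quadratic_family[of "j + 3"] by (simp_all add: \<Xi>_def t_def)
  have real_size: "real (size (\<Xi> j)) = 16 * 2 ^ j + 8 * real j + 23" for j
    by (simp add: size of_nat_diff power_add)
  have real_t: "real (t j) = 128 * 4 ^ j + 16 * 2 ^ j + 16 * real j + 47" for j
    by (simp add: t_def of_nat_diff power_add)
  have nonempty: "\<Xi> j \<noteq> {#}" for j
    using size[of j] by auto
  have "\<exists>\<Xi>' :: nat \<Rightarrow> real multiset. (\<forall>j. \<Xi>' j \<noteq> {#}) \<and> strict_mono (\<lambda>j. size (\<Xi>' j)) \<and>
      transit_time_asymp \<Xi>' (\<lambda>n. sqrt ((3 * real k + 5) / (real k + 1)) * real n)" for k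
  \<comment> \<open>The radicand is \<open>3 + 2 / (k + 1)\<close>, between 3 and 5, so
    \<open>d = 3\<close> and the same family serve every \<open>k\<close>.\<close>
  proof (rule transit_time_asymp_linear[where d = 3, OF _ _ transit nonempty])
    show "1 < sqrt ((3 * real k + 5) / (real k + 1))"
      by (simp add: field_simps)
    have "(3 * real k + 5) / (real k + 1) \<le> 3\<^sup>2"
      by (simp add: field_simps)
    then show "sqrt ((3 * real k + 5) / (real k + 1)) \<le> 3"
      by (intro real_le_lsqrt) simp_all
  next
    fix j
    have "(2::real) ^ j \<le> 4 ^ j" "real j \<le> 2 ^ j" "(1::real) \<le> 2 ^ j"
      using of_nat_less_two_power[of j, where 'a = real] by (simp_all add: power_mono)
    then show "3 * (real (size (\<Xi> j)) + 1) \<le> real (t j)"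
      unfolding real_size real_t by argo
    show "real (t j) + 3 \<le> real (t (Suc j))"
      unfolding real_t by simp
  qed
  moreover have "strict_mono (\<lambda>j. size (\<Xi> j))"
  proof -
    have "real (size (\<Xi> j)) < real (size (\<Xi> (Suc j)))" for j
      unfolding real_size by (simp add: add_pos_pos)
    then show ?thesis
      by (simp add: strict_mono_Suc_iff)
  qed
  \<comment> \<open>Both \<open>t j\<close> and half the squared size have leading term
    \<open>128 * 4 ^ j\<close>.\<close>
  moreover have "transit_time_asymp \<Xi> (\<lambda>n. (real n)\<^sup>2 / 2)"
  proof (rule transit_time_asympI[OF transit])
    show "0 < (real (size (\<Xi> j)))\<^sup>2 / 2" for j
      using nonempty[of j] by (simp add: nonempty_has_size)
    \<comment> \<open>\<open>real_asymp\<close> does not identify \<open>4 ^ j\<close> with \<open>(2 ^ j)\<^sup>2\<close>.\<close>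
    have "(\<lambda>j. (128 * (2 ^ j)\<^sup>2 + 16 * 2 ^ j + 16 * real j + 47)
        / ((16 * 2 ^ j + 8 * real j + 23)\<^sup>2 / 2)) \<longlonglongrightarrow> (1::real)"
      by real_asymp
    moreover have "(4::real) ^ j = (2 ^ j)\<^sup>2" for j
      by (simp add: power2_eq_square flip: power_mult_distrib)
    ultimately show "(\<lambda>j. real (t j) / ((real (size (\<Xi> j)))\<^sup>2 / 2)) \<longlonglongrightarrow> 1"
      unfolding real_t real_size by simp
  qed
  ultimately show ?thesis
    using nonempty by blast
qed

end
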